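(* Let $G=(V\cup E,\varepsilon)$ be a connected bipartite graph, with $E$ regarded as the set of hyperedges. Then its exterior polynomial $X_G(y)$ is interpolating, i.e. the set of indices $j$ such that the coefficient of $y^j$ in $X_G(y)$ is non-zero is an integer interval $[n_1,n_2]$ (all integers from $n_1$ to $n_2$, inclusive).
   Context: $G=(V\cup E,\varepsilon)$ denotes a finite simple bipartite graph with non-empty colour classes $V$ and $E$ and edge set $\varepsilon$; the elements of $E$ are called hyperedges. For connected $G$, a hypertree of $G$ is a function $f:E\to\{0,1,2,\dots\}$ for which there is a spanning tree $\tau$ of $G$ with $d_\tau(e)=f(e)+1$ for every $e\in E$. For distinct $e,e'\in E$, we say that $e$ can transfer valence to $e'$ with respect to a hypertree $f$ if the function obtained from $f$ by decreasing $f(e)$ by 1 and increasing $f(e')$ by 1 is also a hypertree. Fix a total order on $E$. A hyperedge $e$ is externally inactive with respect to $f$ if there is $e'<e$ such that $e'$ can transfer valence to $e$ with respect to $f$; otherwise it is externally active. Let $\overline{\epsilon}(f)$ be the number of externally inactive hyperedges. The exterior polynomial is $X_G(y)=\sum_f y^{\overline{\epsilon}(f)}$, the sum being over all hypertrees $f$ of $G$. It is known that $X_G$ does not depend on the order on $E$ (but it may depend on which colour class is taken as the set of hyperedges). *)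

theory Defs
  imports
    "HOL-Computational_Algebra.Polynomial"
    "HOL-Library.FuncSet"
    "Graph_Theory.Digraph_Component"
begin

text \<open>
  As in the library, a finite simple graph is a finite symmetric loop-free digraph
  (\<^locale>\<open>pair_graph\<close>): an edge \<open>uv\<close> is the pair of arcs \<open>(u, v)\<close> and \<open>(v, u)\<close>, and the degree
  of \<open>v\<close> is the out-degree.
\<close>

locale bipartite_graph = pair_graph G for G :: "'a pair_pre_digraph" +
  fixes V E :: "'a set"
  assumes verts_eq: "pverts G = V \<union> E"
    and classes_disjoint: "V \<inter> E = {}"
    and V_nonempty: "V \<noteq> {}"
    and E_nonempty: "E \<noteq> {}"
    and arcs_between: "(u, w) \<in> parcs G \<Longrightarrow> u \<in> V \<and> w \<in> E \<or> u \<in> E \<and> w \<in> V"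

text \<open>
  The library predicates \<^const>\<open>forest\<close> and \<^const>\<open>tree\<close> are about directed cycles; in a symmetric
  digraph these include the back-and-forth walk \<open>u, v, u\<close> along a single edge. The directed cycles
  of length at least 3 are exactly the cycles of the undirected simple graph.
\<close>

definition undirected_tree :: "'a pair_pre_digraph \<Rightarrow> bool" where
  "undirected_tree T \<longleftrightarrow>
     pair_graph T \<and> connected T \<and> \<not> (\<exists>p. pre_digraph.cycle T p \<and> length p \<ge> 3)"

definition is_spanning_tree :: "'a pair_pre_digraph \<Rightarrow> 'a pair_pre_digraph \<Rightarrow> bool" where
  "is_spanning_tree T G \<longleftrightarrow> undirected_tree T \<and> spanning T G"

text \<open>
  A function on \<open>E\<close> is represented by its extension with the value \<^const>\<open>undefined\<close> outside \<open>E\<close>, so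
  that distinct hypertrees differ on \<open>E\<close>.
\<close>

definition hypertree :: "'a pair_pre_digraph \<Rightarrow> 'a set \<Rightarrow> ('a \<Rightarrow> nat) \<Rightarrow> bool" where
  "hypertree G E f \<longleftrightarrow>
     f \<in> extensional E \<and> (\<exists>T. is_spanning_tree T G \<and> (\<forall>e\<in>E. out_degree T e = f e + 1))"

text \<open>The condition \<open>f e \<ge> 1\<close> guards the truncated subtraction: hypertrees are non-negative.\<close>

definition can_transfer ::
  "'a pair_pre_digraph \<Rightarrow> 'a set \<Rightarrow> ('a \<Rightarrow> nat) \<Rightarrow> 'a \<Rightarrow> 'a \<Rightarrow> bool" where
  "can_transfer G E f e e' \<longleftrightarrow>
     e \<in> E \<and> e' \<in> E \<and> e \<noteq> e' \<and> f e \<ge> 1 \<and> hypertree G E (f(e := f e - 1, e' := f e' + 1))"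

text \<open>
  The order on \<open>E\<close> is a relation \<open>r\<close> with \<^term>\<open>linear_order_on E r\<close>; it is reflexive, whence the
  condition \<open>e' \<noteq> e\<close>.
\<close>

definition externally_inactive ::
  "'a pair_pre_digraph \<Rightarrow> 'a set \<Rightarrow> 'a rel \<Rightarrow> ('a \<Rightarrow> nat) \<Rightarrow> 'a \<Rightarrow> bool" where
  "externally_inactive G E r f e \<longleftrightarrow>
     (\<exists>e'\<in>E. (e', e) \<in> r \<and> e' \<noteq> e \<and> can_transfer G E f e' e)"

definition ext_inactivity ::
  "'a pair_pre_digraph \<Rightarrow> 'a set \<Rightarrow> 'a rel \<Rightarrow> ('a \<Rightarrow> nat) \<Rightarrow> nat" where
  "ext_inactivity G E r f = card {e \<in> E. externally_inactive G E r f e}"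

definition exterior_poly :: "'a pair_pre_digraph \<Rightarrow> 'a set \<Rightarrow> 'a rel \<Rightarrow> int poly" where
  "exterior_poly G E r = (\<Sum>f | hypertree G E f. monom 1 (ext_inactivity G E r f))"

text \<open>The sum above is over a finite set, so it is not the default value \<open>0\<close> of an infinite sum.\<close>

lemma (in bipartite_graph) finite_hypertrees: "finite {f. hypertree G E f}"
proof (rule finite_subset)
  let ?D = "(\<lambda>(X, Y). \<lparr>pverts = X, parcs = Y\<rparr>) ` (Pow (pverts G) \<times> Pow (parcs G))"
  show "finite ((\<lambda>T. restrict (\<lambda>e. out_degree (with_proj T) e - 1) E) ` ?D)"
    using pair_finite_verts pair_finite_arcs by auto
  show "{f. hypertree G E f} \<subseteq> (\<lambda>T. restrict (\<lambda>e. out_degree (with_proj T) e - 1) E) ` ?D"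
  proof
    fix f assume "f \<in> {f. hypertree G E f}"
    then obtain T where f: "f \<in> extensional E"
      and T: "is_spanning_tree T G" and d: "\<forall>e\<in>E. out_degree (with_proj T) e = f e + 1"
      by (auto simp: hypertree_def)
    have "pverts T \<subseteq> pverts G" "parcs T \<subseteq> parcs G"
      using T by (auto simp: is_spanning_tree_def spanning_def subgraph_def)
    then have "T \<in> ?D"
      by (intro image_eqI[of _ _ "(pverts T, parcs T)"]) auto
    moreover have "f = restrict (\<lambda>e. out_degree (with_proj T) e - 1) E"
      using f d by (intro extensionalityI[of _ E]) auto
    ultimately show "f \<in> (\<lambda>T. restrict (\<lambda>e. out_degree (with_proj T) e - 1) E) ` ?D"
      by blast
  qed
qed

definition interpolating :: "'b::zero poly \<Rightarrow> bool" where
  "interpolating p \<longleftrightarrow> (\<exists>n1 n2. n1 \<le> n2 \<and> {j. coeff p j \<noteq> 0} = {n1..n2})"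

end

theory Submission
  imports Defs
begin

text \<open>
  Hypertrees satisfy the exchange axiom of the bases of an integer polymatroid: if \<open>f i < g i\<close> then
  some \<open>j\<close> with \<open>f j > g j\<close> can transfer valence to \<open>i\<close> with respect to \<open>f\<close>. Hence the largest
  hyperedge \<open>m\<close> is inactive exactly when \<open>f m\<close> is below its maximum \<open>b\<close>, and the activity of the
  other hyperedges can be read off inside the slice of all hypertrees with the same value at \<open>m\<close>.
  Every slice is again an exchange system, so by induction the numbers of inactive hyperedges
  occurring in it form an interval starting at 0. In the slice \<open>f m = b\<close> this interval is
  unchanged, in every other slice it is shifted by 1, and the union of these intervals is an interval.
\<close>

section \<open>Trees as minimally connected relations\<close>

text \<open>Both arcs are taken, so that adding or deleting an edge keeps a relation
  symmetric.\<close>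

definition edge :: "'a \<Rightarrow> 'a \<Rightarrow> 'a rel" where
  "edge a b = {(a, b), (b, a)}"

lemma mem_edge [simp]: "(x, y) \<in> edge a b \<longleftrightarrow> x = a \<and> y = b \<or> x = b \<and> y = a"
  by (auto simp: edge_def)

lemma sym_rtranclD: "sym R \<Longrightarrow> (x, y) \<in> R\<^sup>* \<Longrightarrow> (y, x) \<in> R\<^sup>*"
  using sym_rtrancl by (metis symD)

text \<open>Repeated crossings of the new edge can be short-cut, so at most one crossing, in one of
  the two directions, remains.\<close>

lemma rtrancl_Un_edge:
  assumes "(c, d) \<in> (R \<union> edge a b)\<^sup>*"
  shows "(c, d) \<in> R\<^sup>* \<or> (c, a) \<in> R\<^sup>* \<and> (b, d) \<in> R\<^sup>* \<or> (c, b) \<in> R\<^sup>* \<and> (a, d) \<in> R\<^sup>*"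
  using assms by induction (auto intro: rtrancl_into_rtrancl)

definition connected_rel :: "'a set \<Rightarrow> 'a rel \<Rightarrow> bool" where
  "connected_rel X R \<longleftrightarrow> (\<forall>u\<in>X. \<forall>v\<in>X. (u, v) \<in> R\<^sup>*)"

text \<open>Acyclicity is phrased as every edge being a bridge, so that trees are handled by
  reachability alone; loops are excluded because \<open>(a, a)\<close> lies in every reflexive
  closure.\<close>

definition tree_rel :: "'a set \<Rightarrow> 'a rel \<Rightarrow> bool" where
  "tree_rel X R \<longleftrightarrow> R \<subseteq> X \<times> X \<and> sym R \<and> connected_rel X R \<and>
     (\<forall>a b. (a, b) \<in> R \<longrightarrow> (a, b) \<notin> (R - edge a b)\<^sup>*)"

lemma sym_Diff_edge: "sym R \<Longrightarrow> sym (R - edge a b)"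
  by (auto simp: sym_def)

lemma sym_Un_edge: "sym R \<Longrightarrow> sym (R \<union> edge a b)"
  by (auto simp: sym_def)

lemma Diff_edge_Un: "sym R \<Longrightarrow> (p, q) \<in> R \<Longrightarrow> R - edge p q \<union> edge p q = R"
  by (auto simp: sym_def edge_def)

lemma Diff_edge_psubset: "(p, q) \<in> R \<Longrightarrow> R - edge p q \<subset> R"
  by (metis DiffD2 Diff_subset mem_edge psubsetI)

text \<open>In a connected symmetric subrelation of least cardinality every edge is a bridge, as
  deleting any other edge would keep it connected.\<close>

lemma connected_tree_exists:
  assumes "finite R" "R \<subseteq> X \<times> X" "sym R" "connected_rel X R"
  obtains T where "T \<subseteq> R" "tree_rel X T"
proof -
  let ?P = "\<lambda>T. T \<subseteq> R \<and> sym T \<and> connected_rel X T"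
  have "?P R" using assms by blast
  from ex_has_least_nat[of ?P, OF this, of card]
  obtain T where T: "?P T" and min: "\<And>U. ?P U \<Longrightarrow> card T \<le> card U" by blast
  have "(a, b) \<notin> (T - edge a b)\<^sup>*" if ab: "(a, b) \<in> T" for a b
  proof
    let ?U = "T - edge a b"
    assume path: "(a, b) \<in> ?U\<^sup>*"
    then have "(b, a) \<in> ?U\<^sup>*" using T sym_Diff_edge sym_rtranclD by metis
    then have "T \<subseteq> ?U\<^sup>*" using path by (auto simp: edge_def)
    then have "T\<^sup>* \<subseteq> ?U\<^sup>*" by (metis rtrancl_subset_rtrancl)
    then have "?P ?U" using T sym_Diff_edge by (auto simp: connected_rel_def)
    then have "card T \<le> card ?U" by (rule min)
    moreover have "finite T" using T assms(1) by (auto intro: finite_subset)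
    then have "card ?U < card T" using Diff_edge_psubset[OF ab] by (rule psubset_card_mono)
    ultimately show False by simp
  qed
  then have "tree_rel X T" using T assms(2) by (auto simp: tree_rel_def)
  then show ?thesis using T that by blast
qed

text \<open>Deleting \<open>p q\<close> splits the tree into two components; \<open>sep\<close> puts
  \<open>a\<close> and \<open>b\<close> on different sides, so the new edge rejoins them.\<close>

lemma tree_rel_swap:
  assumes S: "tree_rel X S" and pq: "(p, q) \<in> S" and ab: "a \<in> X" "b \<in> X"
    and sep: "(a, b) \<notin> (S - edge p q)\<^sup>*"
  shows "tree_rel X (S - edge p q \<union> edge a b)"
proof -
  let ?R = "S - edge p q" and ?U = "S - edge p q \<union> edge a b"
  have sS: "sym S" and sub: "S \<subseteq> X \<times> X" and con: "connected_rel X S"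
    and br: "\<And>a b. (a, b) \<in> S \<Longrightarrow> (a, b) \<notin> (S - edge a b)\<^sup>*"
    using S by (auto simp: tree_rel_def)
  have sR: "sym ?R" using sS by (rule sym_Diff_edge)
  have sU: "sym ?U" using sR by (rule sym_Un_edge)
  have SU: "S = ?R \<union> edge p q" using Diff_edge_Un[OF sS pq] by simp
  have RU: "?R\<^sup>* \<subseteq> ?U\<^sup>*" by (intro rtrancl_mono) auto
  have "(a, b) \<in> (?R \<union> edge p q)\<^sup>*" using con ab SU by (auto simp: connected_rel_def)
  from rtrancl_Un_edge[OF this] sep
  have "(a, p) \<in> ?R\<^sup>* \<and> (q, b) \<in> ?R\<^sup>* \<or> (a, q) \<in> ?R\<^sup>* \<and> (p, b) \<in> ?R\<^sup>*" by blast
  then have "(a, p) \<in> ?U\<^sup>* \<and> (q, b) \<in> ?U\<^sup>* \<or> (a, q) \<in> ?U\<^sup>* \<and> (p, b) \<in> ?U\<^sup>*" using RU by blast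
  moreover have "(a, b) \<in> ?U\<^sup>*" by auto
  ultimately have "(p, q) \<in> ?U\<^sup>*" using sym_rtranclD[OF sU] by (meson rtrancl_trans)
  then have "edge p q \<subseteq> ?U\<^sup>*" using sym_rtranclD[OF sU] by (simp add: edge_def)
  then have "S \<subseteq> ?U\<^sup>*" using SU by blast
  then have "S\<^sup>* \<subseteq> ?U\<^sup>*" by (metis rtrancl_subset_rtrancl)
  then have conU: "connected_rel X ?U" using con by (auto simp: connected_rel_def)
  have "(c, d) \<notin> (?U - edge c d)\<^sup>*" if cd: "(c, d) \<in> ?U" for c d
  proof
    assume path: "(c, d) \<in> (?U - edge c d)\<^sup>*"
    show False
    proof (cases "(c, d) \<in> edge a b")
      case True
      then have "(?U - edge c d)\<^sup>* \<subseteq> ?R\<^sup>*" by (intro rtrancl_mono) auto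
      then have "(a, b) \<in> ?R\<^sup>*" using True path sym_rtranclD[OF sR] by auto
      then show False using sep by blast
    next
      \<comment> \<open>If an old edge \<open>c d\<close> stopped being a bridge, the detour would
        cross \<open>a b\<close>; its remainder together with \<open>c d\<close> would join
        \<open>a\<close> to \<open>b\<close> without \<open>p q\<close>.\<close>
      case False
      then have cdR: "(c, d) \<in> ?R" using cd by auto
      let ?Q = "?R - edge c d"
      have sQ: "sym ?Q" using sR by (rule sym_Diff_edge)
      have QR: "?Q\<^sup>* \<subseteq> ?R\<^sup>*" by (intro rtrancl_mono) auto
      have "(?U - edge c d)\<^sup>* \<subseteq> (?Q \<union> edge a b)\<^sup>*" by (intro rtrancl_mono) auto
      then have "(c, d) \<in> (?Q \<union> edge a b)\<^sup>*" using path by blast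
      moreover have "(c, d) \<notin> ?Q\<^sup>*"
        using br[of c d] cdR rtrancl_mono[of ?Q "S - edge c d"] by blast
      ultimately have "(c, a) \<in> ?Q\<^sup>* \<and> (b, d) \<in> ?Q\<^sup>* \<or> (c, b) \<in> ?Q\<^sup>* \<and> (a, d) \<in> ?Q\<^sup>*"
        using rtrancl_Un_edge by fast
      then have "(c, a) \<in> ?R\<^sup>* \<and> (b, d) \<in> ?R\<^sup>* \<or> (c, b) \<in> ?R\<^sup>* \<and> (a, d) \<in> ?R\<^sup>*"
        using QR by blast
      moreover have "(c, d) \<in> ?R\<^sup>*" using cdR by blast
      ultimately have "(a, b) \<in> ?R\<^sup>*" using sym_rtranclD[OF sR] by (meson rtrancl_trans)
      then show False using sep by blast
    qed
  qed
  then show ?thesis using sU conU sub ab unfolding tree_rel_def by (auto simp: edge_def)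
qed

text \<open>The path of \<open>S\<close> from \<open>a\<close> to \<open>b\<close> must leave
  \<open>T\<close>, since inside \<open>T\<close> it would close a cycle with \<open>(a, b)\<close>;
  any edge of it outside \<open>T\<close> will do.\<close>

lemma tree_rel_separating_edge:
  assumes S: "tree_rel X S" and "finite S" and T: "tree_rel X T" and xT: "(a, b) \<in> T" "(a, b) \<notin> S"
  obtains p q where "(p, q) \<in> S" "(p, q) \<notin> T" "(a, b) \<notin> (S - edge p q)\<^sup>*"
proof (rule ccontr)
  assume "\<not> thesis"
  then have all: "\<And>p q. (p, q) \<in> S \<Longrightarrow> (p, q) \<notin> T \<Longrightarrow> (a, b) \<in> (S - edge p q)\<^sup>*"
    using that by blast
  have sS: "sym S" and sT: "sym T" using S T by (auto simp: tree_rel_def)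
  \<comment> \<open>Instead of a path, a least relation joining \<open>a\<close> to \<open>b\<close>
    is used; keeping all of \<open>S \<inter> T\<close> means that only edges outside
    \<open>T\<close> are ever pruned.\<close>
  let ?P = "\<lambda>R. S \<inter> T \<subseteq> R \<and> R \<subseteq> S \<and> sym R \<and> (a, b) \<in> R\<^sup>*"
  have "a \<in> X" "b \<in> X" using T xT by (auto simp: tree_rel_def)
  then have "?P S" using S by (auto simp: tree_rel_def connected_rel_def)
  from ex_has_least_nat[of ?P, OF this, of card]
  obtain R where R: "?P R" and min: "\<And>U. ?P U \<Longrightarrow> card R \<le> card U" by blast
  have "R \<subseteq> T"
  proof (rule ccontr)
    assume "\<not> R \<subseteq> T"
    then obtain p q where pq: "(p, q) \<in> R" "(p, q) \<notin> T" by auto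
    let ?U = "R - edge p q" and ?V = "S - edge p q"
    have sU: "sym ?U" and sV: "sym ?V" using R sS by (simp_all add: sym_Diff_edge)
    have qp: "(q, p) \<notin> T" using pq sT by (auto dest: symD)
    have "finite R" using R assms(2) by (auto intro: finite_subset)
    then have "card ?U < card R" using Diff_edge_psubset[OF pq(1)] by (rule psubset_card_mono)
    then have "\<not> ?P ?U" using min[of ?U] by linarith
    then have "(a, b) \<notin> ?U\<^sup>*" using R sU qp pq by auto
    moreover have "(a, b) \<in> (?U \<union> edge p q)\<^sup>*" using Diff_edge_Un[of R p q] R pq by auto
    ultimately have "(a, p) \<in> ?U\<^sup>* \<and> (q, b) \<in> ?U\<^sup>* \<or> (a, q) \<in> ?U\<^sup>* \<and> (p, b) \<in> ?U\<^sup>*"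
      using rtrancl_Un_edge by fast
    moreover have "?U\<^sup>* \<subseteq> ?V\<^sup>*" using R by (intro rtrancl_mono) auto
    ultimately have "(a, p) \<in> ?V\<^sup>* \<and> (q, b) \<in> ?V\<^sup>* \<or> (a, q) \<in> ?V\<^sup>* \<and> (p, b) \<in> ?V\<^sup>*" by blast
    \<comment> \<open>Minimality says that \<open>R\<close> needs \<open>p q\<close>, while
      \<open>all\<close> gives a way round it in \<open>S\<close>; combined they join
      \<open>p\<close> to \<open>q\<close> without that edge.\<close>
    moreover have "(a, b) \<in> ?V\<^sup>*" using all pq R by blast
    ultimately have "(p, q) \<in> ?V\<^sup>*" using sym_rtranclD[OF sV] by (meson rtrancl_trans)
    then show False using S pq R by (auto simp: tree_rel_def)
  qed
  then have "R \<subseteq> T - edge a b" using R xT symD[OF sS, of b a] by (auto simp: edge_def)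
  then have "(a, b) \<in> (T - edge a b)\<^sup>*" using R rtrancl_mono[of R] by blast
  then show False using T xT by (auto simp: tree_rel_def)
qed

section \<open>Degree vectors of spanning trees\<close>

text \<open>
  Swapping an edge of \<open>T - S\<close> at \<open>i\<close> into \<open>S\<close> removes an edge at some \<open>p\<close>. If \<open>p\<close> is not
  yet as required, it has become deficient with respect to \<open>T\<close>, and the argument is repeated at
  \<open>p\<close>; each swap brings \<open>S\<close> closer to \<open>T\<close>.
\<close>

lemma tree_degree_exchange:
  assumes T: "tree_rel X T" and fin: "finite X"
    and bip: "\<And>u w. (u, w) \<in> R \<Longrightarrow> u \<in> V \<and> w \<in> E \<or> u \<in> E \<and> w \<in> V" and disj: "V \<inter> E = {}"
    and sR: "sym R" and TR: "T \<subseteq> R"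
    and "tree_rel X S" "S \<subseteq> R" "i \<in> E" "card (S `` {i}) < card (T `` {i})"
  shows "\<exists>S' j. tree_rel X S' \<and> S' \<subseteq> R \<and> j \<in> E \<and> card (T `` {j}) < card (S `` {j}) \<and>
    (\<forall>e\<in>E. card (S' `` {e}) + (if e = j then 1 else 0) = card (S `` {e}) + (if e = i then 1 else 0))"
  using assms(7-10)
proof (induction "card (T - S)" arbitrary: S i rule: less_induct)
  case less
  have finS: "finite U" if "tree_rel X U" for U
    using that fin finite_subset[of U "X \<times> X"] by (simp add: tree_rel_def)
  have finIm: "finite (U `` {v})" if "tree_rel X U" for U v
    using finS[OF that] by (rule finite_Image)
  have "\<not> T `` {i} \<subseteq> S `` {i}"
    using less.prems finIm card_mono by (metis not_le)
  then obtain b where ib: "(i, b) \<in> T" "(i, b) \<notin> S" by auto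
  then have b: "b \<in> V" using bip TR \<open>i \<in> E\<close> disj by blast
  have bE: "b \<notin> E" using b disj by blast
  have iX: "i \<in> X" "b \<in> X" using T ib by (auto simp: tree_rel_def)
  have sS: "sym S" and sT: "sym T" using less.prems T by (auto simp: tree_rel_def)
  obtain p' q' where pq': "(p', q') \<in> S" "(p', q') \<notin> T" "(i, b) \<notin> (S - edge p' q')\<^sup>*"
    using tree_rel_separating_edge[OF less.prems(1) finS[OF less.prems(1)] T ib] by blast
  \<comment> \<open>By bipartiteness one end of the removed edge is a hyperedge; it is named
    \<open>p\<close>.\<close>
  obtain p q where pq: "(p, q) \<in> S" "(p, q) \<notin> T" "(i, b) \<notin> (S - edge p q)\<^sup>*"
    and pE: "p \<in> E" and qV: "q \<in> V"
  proof (cases "p' \<in> E")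
    case True
    then show ?thesis using that pq' bip[of p' q'] less.prems disj by blast
  next
    case False
    then have "p' \<in> V" "q' \<in> E" using pq' bip[of p' q'] less.prems by blast+
    moreover have "edge p' q' = edge q' p'" by (auto simp: edge_def)
    ultimately show ?thesis using that[of q' p'] pq' sS sT by (auto dest: symD)
  qed
  let ?S = "S - edge p q \<union> edge i b"
  have S1: "tree_rel X ?S"
    using tree_rel_swap less.prems(1) pq iX by metis
  have S1R: "?S \<subseteq> R"
    using less.prems(2) ib TR symD[OF sR] by (auto simp: edge_def)
  have qE: "q \<notin> E" using qV disj by blast
  \<comment> \<open>The ends \<open>b\<close> and \<open>q\<close> lie in \<open>V\<close>, so among
    hyperedges the swap moves one unit of degree from \<open>p\<close> to \<open>i\<close>; for
    \<open>p = i\<close> nothing changes.\<close>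
  have deg: "card (?S `` {e}) + (if e = p then 1 else 0) = card (S `` {e}) + (if e = i then 1 else 0)"
    if "e \<in> E" for e
  proof -
    have "?S `` {e} = (S `` {e} - (if e = p then {q} else {})) \<union> (if e = i then {b} else {})"
      using that qE bE by auto
    moreover have "e = p \<Longrightarrow> q \<in> S `` {e}" "e = i \<Longrightarrow> b \<notin> S `` {e}" using pq ib by auto
    moreover have "e = p \<Longrightarrow> card (S `` {e}) > 0"
      using calculation(2) finIm[OF less.prems(1)] by (auto simp: card_gt_0_iff)
    ultimately show ?thesis
      using finIm[OF less.prems(1), of e] by auto
  qed
  have lt: "card (T - ?S) < card (T - S)"
  proof (rule psubset_card_mono)
    show "finite (T - S)" using finS[OF T] by blast
    have "T \<inter> edge p q = {}" using pq sT by (auto simp: edge_def dest: symD)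
    then show "T - ?S \<subset> T - S" using ib by (auto simp: edge_def)
  qed
  show ?case
  proof (cases "card (T `` {p}) < card (S `` {p})")
    case True
    then show ?thesis using S1 S1R pE deg by (intro exI[of _ ?S] exI[of _ p]) blast
  next
    case False
    \<comment> \<open>Here \<open>S\<close> has at most the degree of \<open>T\<close> at
      \<open>p\<close>; losing an edge makes \<open>p\<close> deficient, and for
      \<open>p = i\<close> the old deficiency persists.\<close>
    have "card (?S `` {p}) < card (T `` {p})"
      using False deg[OF pE] less.prems by (cases "p = i") auto
    then obtain S' j where S': "tree_rel X S'" "S' \<subseteq> R" "j \<in> E" "card (T `` {j}) < card (?S `` {j})"
      and deg': "\<And>e. e \<in> E \<Longrightarrow>
        card (S' `` {e}) + (if e = j then 1 else 0) = card (?S `` {e}) + (if e = p then 1 else 0)"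
      using less.hyps[OF lt S1 S1R pE] by blast
    \<comment> \<open>At \<open>i\<close> the swapped tree has at most the degree of
      \<open>T\<close>, because \<open>S\<close> had strictly less; so the surplus at
      \<open>j\<close> was already present in \<open>S\<close>.\<close>
    have "j \<noteq> i" using S' deg[of i] less.prems(3,4) by (auto split: if_splits)
    then have "card (T `` {j}) < card (S `` {j})"
      using S'(4) deg[OF S'(3)] by (auto split: if_splits)
    moreover have "card (S' `` {e}) + (if e = j then 1 else 0) = card (S `` {e}) + (if e = i then 1 else 0)"
      if "e \<in> E" for e
      using deg[OF that] deg'[OF that] by presburger
    ultimately show ?thesis using S' by blast
  qed
qed

section \<open>Spanning trees of the graph as tree relations\<close>

lemma pcas_rtrancl: "pcas u p v \<Longrightarrow> (u, v) \<in> (set p)\<^sup>*"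
proof (induction p arbitrary: u)
  case (Cons e p)
  then have "(snd e, v) \<in> (set p)\<^sup>*" "fst e = u" by auto
  then have "(snd e, v) \<in> (set (e # p))\<^sup>*" "(u, snd e) \<in> set (e # p)"
    using rtrancl_mono[of "set p" "set (e # p)"] by auto
  then show ?case by (rule converse_rtrancl_into_rtrancl[rotated])
qed simp

lemma pawalk_verts_ends:
  "e \<in> set p \<Longrightarrow> pcas u p v \<Longrightarrow> fst e \<in> set (pawalk_verts u p) \<and> snd e \<in> set (pawalk_verts u p)"
proof (induction p arbitrary: u)
  case (Cons e' p)
  have "pcas w p v \<Longrightarrow> w \<in> set (pawalk_verts w p)" for w by (cases p) auto
  with Cons show ?case by auto
qed simp

text \<open>Deleting one edge of a cycle leaves a detour between its ends; conversely a simple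
  detour is closed to a cycle by the deleted edge. The length bound discards back-and-forth
  walks.\<close>

lemma long_cycle_iff_non_bridge:
  assumes "pair_graph T"
  shows "(\<exists>p. pre_digraph.cycle T p \<and> length p \<ge> 3) \<longleftrightarrow>
    (\<exists>a b. (a, b) \<in> parcs T \<and> (a, b) \<in> (parcs T - edge a b)\<^sup>*)" (is "?L \<longleftrightarrow> ?R")
proof
  interpret pair_graph T by fact
  have sT: "sym (parcs T)" using pair_sym_arcs by (simp add: symmetric_def)
  show ?R if ?L
  proof -
    from that obtain c u where c: "awalk u c u" "distinct (tl (pawalk_verts u c))" "length c \<ge> 3"
      by (auto simp: cycle_def)
    then obtain v p where cp: "c = (u, v) # p" by (cases c) (auto simp: awalk_Cons_iff)
    have p: "pcas v p u" "set p \<subseteq> parcs T" "distinct (pawalk_verts v p)" "length p \<ge> 2"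
      and uv: "(u, v) \<in> parcs T"
      using c cp by (auto simp: awalk_def)
    obtain w p' where pp: "p = (v, w) # p'" and p': "p' \<noteq> []"
      using p by (cases p) (auto, case_tac list, auto)
    have w: "pcas w p' u" "v \<notin> set (pawalk_verts w p')" "distinct (pawalk_verts w p')"
      using p pp by auto
    have wu: "w \<noteq> u"
    proof
      assume "w = u"
      then have "apath u p' u" using w p pp uv in_arcsD1 by (auto simp: apath_def awalk_def)
      then show False using p' apath_nonempty_ends by blast
    qed
    \<comment> \<open>The first arc of the detour leads to \<open>w \<noteq> u\<close> and the later
      ones avoid \<open>v\<close>, so none uses the edge \<open>u v\<close>.\<close>
    have "u \<noteq> v" using pair_no_loops[OF uv] by auto
    then have "set p \<inter> edge u v = {}"
      using pp wu w(2) pawalk_verts_ends[OF _ w(1)] by (fastforce simp: edge_def)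
    then have "set p \<subseteq> parcs T - edge u v" using p by blast
    then have "(v, u) \<in> (parcs T - edge u v)\<^sup>*" using pcas_rtrancl[OF p(1)] rtrancl_mono by blast
    then have "(u, v) \<in> (parcs T - edge u v)\<^sup>*"
      using sym_rtranclD sym_Diff_edge sT by metis
    then show ?R using uv by blast
  qed
  show ?L if ?R
  proof -
    from that obtain a b where ab: "(a, b) \<in> parcs T" "(a, b) \<in> (parcs T - edge a b)\<^sup>*" by blast
    have ne: "a \<noteq> b" using pair_no_loops[OF ab(1)] by auto
    let ?U = "\<lparr>pverts = pverts T, parcs = parcs T - edge a b\<rparr>"
    interpret U: pair_wf_digraph ?U
      using arc_fst_in_verts arc_snd_in_verts by unfold_locales auto
    have "(a, b) \<in> rtrancl_on (pverts T) (parcs T - edge a b)"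
      using ab in_arcsD1 in_arcsD2 by (intro rtrancl_consistent_rtrancl_on) auto
    then have "a \<rightarrow>\<^sup>*\<^bsub>?U\<^esub> b" by (simp add: reachable_def)
    then obtain p where p: "U.apath a p b" using U.reachable_apath by blast
    have "awalk a p b" "distinct (pawalk_verts a p)"
      using p by (auto simp: U.apath_def U.awalk_def awalk_def)
    moreover have "(b, a) \<in> parcs T" using ab sT by (auto dest: symD)
    ultimately have "cycle ((b, a) # p)"
      using in_arcsD2[OF ab(1)] by (auto simp: cycle_def awalk_Cons_iff intro!: exI[of _ b])
    \<comment> \<open>The detour is neither empty, as \<open>a \<noteq> b\<close>, nor the single
      deleted arc, so the cycle has length at least 3.\<close>
    moreover have "p \<noteq> []" "\<And>e. p \<noteq> [e]"
      using p ne by (auto simp: U.apath_def U.awalk_def)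
    then have "length p \<ge> 2" by (cases p) (auto, case_tac list, auto)
    ultimately show ?L by (intro exI[of _ "(b, a) # p"]) auto
  qed
qed

lemma (in pair_graph) connected_iff_connected_rel:
  "connected G \<longleftrightarrow> pverts G \<noteq> {} \<and> connected_rel (pverts G) (parcs G)"
proof -
  have "(parcs G)\<^sup>s = parcs G"
    using pair_sym_arcs by (auto simp: symcl_def symmetric_def dest: symD)
  moreover have "(u, v) \<in> rtrancl_on (pverts G) (parcs G) \<longleftrightarrow> (u, v) \<in> (parcs G)\<^sup>*"
    if "u \<in> pverts G" "v \<in> pverts G" for u v
    using that in_arcsD2 rtrancl_on_rtranclI[of u v]
    by (metis rtrancl_consistent_rtrancl_on)
  ultimately show ?thesis by (simp add: connected_conv connected_rel_def)
qed

lemma (in pair_graph) is_spanning_tree_iff_tree_rel: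
  assumes "pverts G \<noteq> {}"
  shows "is_spanning_tree T G \<longleftrightarrow>
    pverts T = pverts G \<and> parcs T \<subseteq> parcs G \<and> tree_rel (pverts G) (parcs T)" (is "?L \<longleftrightarrow> ?R")
proof
  assume L: ?L
  then interpret T: pair_graph T by (simp add: is_spanning_tree_def undirected_tree_def)
  have vs: "pverts T = pverts G" and sub: "parcs T \<subseteq> parcs G"
    using L by (auto simp: is_spanning_tree_def spanning_def subgraph_def)
  have "parcs T \<subseteq> pverts G \<times> pverts G" "sym (parcs T)"
    using T.in_arcsD1 T.in_arcsD2 vs T.pair_sym_arcs by (auto simp: symmetric_def)
  moreover have "connected_rel (pverts G) (parcs T)"
    using L vs T.connected_iff_connected_rel by (auto simp: is_spanning_tree_def undirected_tree_def)
  moreover have "(a, b) \<notin> (parcs T - edge a b)\<^sup>*" if "(a, b) \<in> parcs T" for a b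
    using L long_cycle_iff_non_bridge[OF T.pair_graph_axioms] that
    by (auto simp: is_spanning_tree_def undirected_tree_def)
  ultimately show ?R using vs sub by (auto simp: tree_rel_def)
next
  assume R: ?R
  then have t: "parcs T \<subseteq> pverts T \<times> pverts T" "sym (parcs T)"
    by (auto simp: tree_rel_def)
  interpret T: pair_graph T
    using t R pair_finite_verts pair_finite_arcs pair_no_loops
    by unfold_locales (auto simp: symmetric_def intro: finite_subset)
  have "connected T"
    using R assms T.connected_iff_connected_rel by (auto simp: tree_rel_def)
  moreover have "spanning T G"
    using R T.wf_digraph_axioms wf_digraph_axioms by (auto simp: spanning_def subgraph_def)
  moreover have "\<not> (\<exists>p. T.cycle p \<and> length p \<ge> 3)"
    using R long_cycle_iff_non_bridge[OF T.pair_graph_axioms] by (auto simp: tree_rel_def)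
  ultimately show ?L
    using T.pair_graph_axioms by (auto simp: is_spanning_tree_def undirected_tree_def)
qed

lemma out_degree_pair: "out_degree (with_proj T) v = card (parcs T `` {v})"
proof -
  have "out_arcs (with_proj T) v = Pair v ` (parcs T `` {v})"
    by (auto simp: out_arcs_def)
  then show ?thesis by (simp add: out_degree_def card_image inj_on_def)
qed

section \<open>The exchange property of hypertrees\<close>

lemma total_order_max:
  assumes "total_on X r" "trans r" and "finite A" "A \<noteq> {}" "A \<subseteq> X"
  shows "\<exists>m\<in>A. \<forall>e\<in>A. e \<noteq> m \<longrightarrow> (e, m) \<in> r"
  using assms(3-5)
proof (induction A rule: finite_ne_induct)
  case (insert x A)
  then obtain m where m: "m \<in> A" "\<forall>e\<in>A. e \<noteq> m \<longrightarrow> (e, m) \<in> r" by auto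
  have "x \<noteq> m" using m insert.hyps by blast
  then consider "(x, m) \<in> r" | "(m, x) \<in> r"
    using assms(1) insert.prems m by (auto simp: total_on_def)
  then show ?case
  proof cases
    case 1
    then show ?thesis using m by auto
  next
    case 2
    then have "(e, x) \<in> r" if "e \<in> A" for e
      using that m(2) assms(2) by (metis transE)
    then show ?thesis by auto
  qed
qed simp

context bipartite_graph
begin

lemma hypertree_iff:
  "hypertree G E f \<longleftrightarrow> f \<in> extensional E \<and>
    (\<exists>T \<subseteq> parcs G. tree_rel (pverts G) T \<and> (\<forall>e\<in>E. card (T `` {e}) = f e + 1))"
    (is "_ \<longleftrightarrow> _ \<and> ?R")
proof -
  have ne: "pverts G \<noteq> {}" using verts_eq V_nonempty by simp
  have "(\<exists>T. is_spanning_tree T G \<and> (\<forall>e\<in>E. out_degree T e = f e + 1)) \<longleftrightarrow> ?R" (is "?L \<longleftrightarrow> _")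
  proof
    show ?L if ?R
    proof -
      from that obtain T where "T \<subseteq> parcs G" "tree_rel (pverts G) T"
        "\<forall>e\<in>E. card (T `` {e}) = f e + 1" by blast
      then show ?L
        using is_spanning_tree_iff_tree_rel[OF ne]
        by (intro exI[of _ "\<lparr>pverts = pverts G, parcs = T\<rparr>"]) (auto simp: out_degree_pair)
    qed
  qed (use is_spanning_tree_iff_tree_rel[OF ne] in \<open>auto simp: out_degree_pair\<close>)
  then show ?thesis by (simp add: hypertree_def)
qed

lemma hypertree_exists:
  assumes "connected G"
  shows "\<exists>f. hypertree G E f"
proof -
  have "parcs G \<subseteq> pverts G \<times> pverts G" "sym (parcs G)"
    using in_arcsD1 in_arcsD2 pair_sym_arcs by (auto simp: symmetric_def)
  then obtain T where T: "T \<subseteq> parcs G" "tree_rel (pverts G) T"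
    using connected_tree_exists pair_finite_arcs assms connected_iff_connected_rel by metis
  \<comment> \<open>Every hyperedge has a neighbour in the tree, as it is joined to a vertex of
    \<open>V\<close>; hence the truncated subtraction below is exact.\<close>
  have "card (T `` {e}) \<noteq> 0" if e: "e \<in> E" for e
  proof -
    obtain v where v: "v \<in> V" using V_nonempty by blast
    then have "(e, v) \<in> T\<^sup>*" "e \<noteq> v"
      using T e verts_eq classes_disjoint by (auto simp: tree_rel_def connected_rel_def)
    then have "T `` {e} \<noteq> {}" by (auto elim: converse_rtranclE)
    moreover have "finite T" using T pair_finite_arcs finite_subset by blast
    ultimately show ?thesis by auto
  qed
  then have "hypertree G E (restrict (\<lambda>e. card (T `` {e}) - 1) E)"
    using T by (auto simp: hypertree_iff intro!: exI[of _ T])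
  then show ?thesis by blast
qed

text \<open>The tree exchange is applied to spanning trees realising \<open>f\<close> and
  \<open>g\<close>. As degrees are values plus 1, the inequalities carry over, and
  \<open>g j < f j\<close> yields both \<open>j \<noteq> i\<close> and the positivity demanded of a
  transfer.\<close>

lemma hypertree_exchange:
  assumes f: "hypertree G E f" and g: "hypertree G E g" and i: "i \<in> E" "f i < g i"
  obtains j where "g j < f j" "can_transfer G E f j i"
proof -
  obtain S where S: "S \<subseteq> parcs G" "tree_rel (pverts G) S" "\<And>e. e \<in> E \<Longrightarrow> card (S `` {e}) = f e + 1"
    using f by (auto simp: hypertree_iff)
  obtain T where T: "T \<subseteq> parcs G" "tree_rel (pverts G) T" "\<And>e. e \<in> E \<Longrightarrow> card (T `` {e}) = g e + 1"
    using g by (auto simp: hypertree_iff)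
  have "card (S `` {i}) < card (T `` {i})" using S T i by simp
  then obtain S' j where S': "tree_rel (pverts G) S'" "S' \<subseteq> parcs G" and j: "j \<in> E"
      "card (T `` {j}) < card (S `` {j})"
    and deg: "\<And>e. e \<in> E \<Longrightarrow>
      card (S' `` {e}) + (if e = j then 1 else 0) = card (S `` {e}) + (if e = i then 1 else 0)"
    using tree_degree_exchange[OF T(2) pair_finite_verts arcs_between classes_disjoint _ T(1) S(2,1) i(1)]
      pair_sym_arcs
    by (auto simp: symmetric_def)
  have gf: "g j < f j" using S T j by simp
  then have ji: "j \<noteq> i" using i by auto
  have "card (S' `` {e}) = (f(j := f j - 1, i := f i + 1)) e + 1" if "e \<in> E" for e
    using deg[OF that] S(3)[OF that] gf ji by (auto split: if_splits)
  moreover have "f(j := f j - 1, i := f i + 1) \<in> extensional E"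
    using f i j by (auto simp: hypertree_def extensional_def)
  ultimately have "hypertree G E (f(j := f j - 1, i := f i + 1))"
    unfolding hypertree_iff using S' by blast
  then show ?thesis using that gf ji i j by (auto simp: can_transfer_def)
qed

section \<open>Inactive hyperedges in initial segments of the order\<close>

text \<open>
  The last element \<open>m\<close> of an initial segment \<open>S\<close> of \<open>E\<close> is active with respect to \<open>f\<close> exactly when
  \<open>f m\<close> is maximal among the hypertrees that agree with \<open>f\<close> outside \<open>S\<close>, and the activity of the
  other elements of \<open>S\<close> only depends on the hypertrees that agree with \<open>f\<close> outside \<open>S - {m}\<close>.
\<close>

lemma ext_inactivity_downward_closed:
  assumes r: "linear_order_on E r" and "S \<subseteq> E"
    and "\<And>e e'. e \<in> S \<Longrightarrow> (e', e) \<in> r \<Longrightarrow> e' \<in> S"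
    and "hypertree G E f" "k \<le> card {e \<in> S. externally_inactive G E r f e}"
  shows "\<exists>g. hypertree G E g \<and> (\<forall>e. e \<notin> S \<longrightarrow> g e = f e) \<and>
    card {e \<in> S. externally_inactive G E r g e} = k"
  using assms(2-5)
proof (induction "card S" arbitrary: S f k)
  case 0
  have "finite S" using finite_subset[OF 0(2)] verts_eq pair_finite_verts by simp
  then show ?case using 0 by auto
next
  case (Suc n)
  have tot: "total_on E r" and antis: "antisym r" and trans: "trans r"
    using r by (auto simp: linear_order_on_def partial_order_on_def preorder_on_def)
  have finE: "finite E" using verts_eq pair_finite_verts by simp
  have finS: "finite S" using Suc.hyps(2) card_gt_0_iff by force
  have "S \<noteq> {}" using Suc.hyps(2) by auto
  obtain m where m: "m \<in> S" and mmax: "\<And>e. e \<in> S \<Longrightarrow> e \<noteq> m \<Longrightarrow> (e, m) \<in> r"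
    using total_order_max[OF tot trans finS \<open>S \<noteq> {}\<close> Suc.prems(1)] by blast
  have mE: "m \<in> E" using m Suc.prems by blast
  let ?S = "S - {m}"
  let ?I = "\<lambda>S g. {e \<in> S. externally_inactive G E r g e}"
  let ?F = "{g. hypertree G E g \<and> (\<forall>e. e \<notin> S \<longrightarrow> g e = f e)}"
  have finF: "finite ?F" using finite_hypertrees by (rule rev_finite_subset) auto
  define b where "b = Max ((\<lambda>g. g m) ` ?F)"
  have le_b: "g m \<le> b" if "g \<in> ?F" for g
    using that finF unfolding b_def by (intro Max_ge) auto
  have "b \<in> (\<lambda>g. g m) ` ?F"
    unfolding b_def using finF Suc.prems(3) by (intro Max_in) auto
  then obtain h where h: "h \<in> ?F" "h m = b" by auto
  have inact_m: "externally_inactive G E r g m \<longleftrightarrow> g m < b" if g: "g \<in> ?F" for g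
  proof
    assume "externally_inactive G E r g m"
    then obtain e where e: "e \<in> E" "(e, m) \<in> r" "e \<noteq> m" "can_transfer G E g e m"
      by (auto simp: externally_inactive_def)
    \<comment> \<open>The segment is closed downward, so the transfer only changes values inside
      \<open>S\<close> and stays in \<open>?F\<close>.\<close>
    have "e \<in> S" using Suc.prems(2) m e by blast
    then have "g(e := g e - 1, m := g m + 1) \<in> ?F"
      using g e m by (auto simp: can_transfer_def)
    from le_b[OF this] show "g m < b" by simp
  next
    assume "g m < b"
    \<comment> \<open>Exchange against the maximiser \<open>h\<close>: it agrees with
      \<open>g\<close> outside \<open>S\<close>, so the donor \<open>j\<close> lies in
      \<open>S\<close> and precedes \<open>m\<close>.\<close>
    then obtain j where j: "h j < g j" "can_transfer G E g j m"
      using hypertree_exchange[of g h m] g h mE by auto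
    then have "j \<in> S" using g h by fastforce
    moreover have "j \<in> E" "j \<noteq> m" using j by (auto simp: can_transfer_def)
    ultimately show "externally_inactive G E r g m"
      using j mmax by (auto simp: externally_inactive_def)
  qed
  have card_I: "card (?I S g) = card (?I ?S g) + (if g m < b then 1 else 0)" if "g \<in> ?F" for g
  proof -
    have "?I S g = ?I ?S g \<union> (if g m < b then {m} else {})"
      using inact_m[OF that] m by auto
    then show ?thesis using finS by auto
  qed
  \<comment> \<open>This is the induction hypothesis for \<open>?S\<close>, again closed downward
    since \<open>m\<close> is last; fixing the values outside \<open>?S\<close> fixes the value at
    \<open>m\<close>.\<close>
  have step: "\<exists>g \<in> ?F. g m = g' m \<and> card (?I ?S g) = l" if g': "g' \<in> ?F" "l \<le> card (?I ?S g')" for g' l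
  proof -
    have "n = card ?S" using Suc.hyps(2) m finS by simp
    moreover have "?S \<subseteq> E" using Suc.prems by blast
    moreover have "e' \<in> ?S" if "e \<in> ?S" "(e', e) \<in> r" for e e'
      using that Suc.prems(2) mmax antis by (auto dest: antisymD)
    ultimately obtain g where g: "hypertree G E g" "\<forall>e. e \<notin> ?S \<longrightarrow> g e = g' e" "card (?I ?S g) = l"
      using Suc.hyps(1)[of ?S g' l] g' by blast
    then show ?thesis using g' by (intro bexI[of _ g]) auto
  qed
  have fF: "f \<in> ?F" using Suc.prems by simp
  \<comment> \<open>For \<open>k = 0\<close> the slice of \<open>h\<close> is used, where
    \<open>m\<close> is active; otherwise the slice of \<open>f\<close>, where \<open>m\<close>
    accounts for one inactive hyperedge exactly when \<open>f m < b\<close>.\<close>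
  consider "k = 0" | "f m < b" "k > 0" | "\<not> f m < b" by linarith
  then have "\<exists>g \<in> ?F. card (?I S g) = k"
  proof cases
    case 1
    obtain g where "g \<in> ?F" "g m = h m" "card (?I ?S g) = 0" using step[OF h(1), of 0] by blast
    then show ?thesis using 1 card_I[of g] h by (intro bexI[of _ g]) auto
  next
    case 2
    then have "k - 1 \<le> card (?I ?S f)" using card_I[OF fF] Suc.prems(4) by simp
    then obtain g where "g \<in> ?F" "g m = f m" "card (?I ?S g) = k - 1"
      using step[OF fF] by blast
    then show ?thesis using 2 card_I[of g] by (intro bexI[of _ g]) auto
  next
    case 3
    then have "k \<le> card (?I ?S f)" using card_I[OF fF] Suc.prems(4) by simp
    then obtain g where "g \<in> ?F" "g m = f m" "card (?I ?S g) = k"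
      using step[OF fF] by blast
    then show ?thesis using 3 card_I[of g] by (intro bexI[of _ g]) auto
  qed
  then show ?case by blast
qed

text \<open>Each hypertree contributes a monomial with coefficient 1, so coefficients count
  hypertrees and nothing cancels.\<close>

lemma coeff_exterior_poly_nonzero:
  "coeff (exterior_poly G E r) j \<noteq> 0 \<longleftrightarrow> (\<exists>f. hypertree G E f \<and> ext_inactivity G E r f = j)"
proof -
  let ?H = "{f. hypertree G E f}"
  have "coeff (exterior_poly G E r) j = (\<Sum>f\<in>?H. if ext_inactivity G E r f = j then 1 else 0)"
    by (auto simp: exterior_poly_def coeff_sum intro: sum.cong)
  also have "\<dots> = int (card {f \<in> ?H. ext_inactivity G E r f = j})"
    using finite_hypertrees by (simp add: sum.inter_filter[symmetric])
  finally show ?thesis using finite_hypertrees by auto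
qed

end

theorem theorem43:
  fixes G :: "'a pair_pre_digraph" and V E :: "'a set" and r :: "'a rel"
  assumes "bipartite_graph G V E"
    and "connected G"
    and "linear_order_on E r"
  shows "interpolating (exterior_poly G E r)"
proof -
  interpret bipartite_graph G V E by fact
  let ?A = "{j. coeff (exterior_poly G E r) j \<noteq> 0}"
  have A: "?A = ext_inactivity G E r ` {f. hypertree G E f}"
    by (auto simp: coeff_exterior_poly_nonzero)
  then have fin: "finite ?A" and ne: "?A \<noteq> {}"
    using finite_hypertrees hypertree_exists[OF assms(2)] by auto
  \<comment> \<open>Starting from a hypertree of largest inactivity, the whole of \<open>E\<close>
    is taken as the initial segment.\<close>
  have "k \<in> ?A" if k: "k \<le> Max ?A" for k
  proof -
    have "Max ?A \<in> ?A" using fin ne by (rule Max_in)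
    then obtain f where f: "hypertree G E f" "ext_inactivity G E r f = Max ?A"
      unfolding coeff_exterior_poly_nonzero by blast
    have "e' \<in> E" if "(e', e) \<in> r" for e e'
      using assms(3) that
      by (auto simp: linear_order_on_def partial_order_on_def preorder_on_def refl_on_def)
    then show ?thesis
      using ext_inactivity_downward_closed[OF assms(3) subset_refl _ f(1), of k] f(2) k
      unfolding coeff_exterior_poly_nonzero ext_inactivity_def by auto
  qed
  then have "{0..Max ?A} \<subseteq> ?A" unfolding atLeastAtMost_iff subset_iff by blast
  moreover have "?A \<subseteq> {0..Max ?A}"
    using Max_ge[OF fin] unfolding atLeastAtMost_iff subset_iff by blast
  ultimately have "?A = {0..Max ?A}" by (rule equalityI[rotated])
  then show ?thesis unfolding interpolating_def by (intro exI[of _ 0] exI[of _ "Max ?A"]) simp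
qed

end
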